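(* Let $X$ be a weakly Lindelöf determined (WLD) Banach space with $\mathrm{dens}\,X=\mathfrak{c}^+$. Then every dense linear subspace of $X$ contains a biorthogonal system of cardinality $\mathfrak{c}^+$.
   Context: "Subspace" means linear subspace, not necessarily closed. $\mathfrak{c}$ is the cardinality of the continuum, $\mathfrak{c}^+$ its successor cardinal, and $\mathrm{dens}\,X$ is the density character of $X$ (smallest cardinality of a dense subset). A biorthogonal system in a normed space $Z$ is a family $\{z_\gamma;z_\gamma^*\}_{\gamma\in\Gamma}\subseteq Z\times Z^*$ with $\langle z_\alpha^*,z_\beta\rangle=\delta_{\alpha,\beta}$ for all $\alpha,\beta\in\Gamma$; its cardinality is $|\Gamma|$. A biorthogonal system $\{x_\gamma;x_\gamma^*\}_{\gamma\in\Gamma}$ in a Banach space $X$ is an M-basis for $X$ if moreover $\overline{\mathrm{span}}\{x_\gamma\}_{\gamma\in\Gamma}=X$ and $\overline{\mathrm{span}}^{w^*}\{x_\gamma^*\}_{\gamma\in\Gamma}=X^*$. A Banach space $X$ is weakly Lindelöf determined (WLD) if it admits an M-basis $\{x_\gamma;x_\gamma^*\}_{\gamma\in\Gamma}$ such that for every $x^*\in X^*$ the set $\{\gamma\in\Gamma:\langle x^*,x_\gamma\rangle\neq0\}$ is countable. *)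

theory Defs
  imports "HOL-Analysis.Analysis"
begin

unbundle cardinal_syntax

text \<open>
  All spaces are over the reals. A normed space that is only given as a linear subspace \<open>Z\<close> of
  a type has no type of its own, so its dual is represented by functions on the ambient type whose
  values outside \<open>Z\<close> are irrelevant. For \<open>Z = UNIV\<close> these are exactly the bounded linear
  functionals (lemma \<open>dual_on_UNIV\<close>).
\<close>

definition dual_on :: "'a::real_normed_vector set \<Rightarrow> ('a \<Rightarrow> real) set" where
  "dual_on Z = {f. (\<forall>x\<in>Z. \<forall>y\<in>Z. f (x + y) = f x + f y) \<and>
                   (\<forall>c. \<forall>x\<in>Z. f (c *\<^sub>R x) = c * f x) \<and>
                   (\<exists>K. \<forall>x\<in>Z. \<bar>f x\<bar> \<le> K * norm x)}"

lemma dual_on_UNIV: "f \<in> dual_on UNIV \<longleftrightarrow> bounded_linear f"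
proof
  assume "f \<in> dual_on UNIV"
  then obtain K where "\<And>x y. f (x + y) = f x + f y" "\<And>c x. f (c *\<^sub>R x) = c * f x"
    "\<And>x. \<bar>f x\<bar> \<le> K * norm x"
    unfolding dual_on_def by auto
  then show "bounded_linear f"
    by (intro bounded_linear_intro[where K = K]) (auto simp: mult.commute)
next
  assume "bounded_linear f"
  then interpret bounded_linear f .
  obtain K where "\<And>x. norm (f x) \<le> norm x * K"
    using bounded by blast
  then show "f \<in> dual_on UNIV"
    unfolding dual_on_def by (auto simp: add scaleR mult.commute intro!: exI[of _ K])
qed

definition biorthogonal_system ::
  "'a::real_normed_vector set \<Rightarrow> 'i set \<Rightarrow> ('i \<Rightarrow> 'a) \<Rightarrow> ('i \<Rightarrow> 'a \<Rightarrow> real) \<Rightarrow> bool" where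
  "biorthogonal_system Z \<Gamma> z z' \<longleftrightarrow>
     (\<forall>\<gamma>\<in>\<Gamma>. z \<gamma> \<in> Z \<and> z' \<gamma> \<in> dual_on Z) \<and>
     (\<forall>\<alpha>\<in>\<Gamma>. \<forall>\<beta>\<in>\<Gamma>. z' \<alpha> (z \<beta>) = (if \<alpha> = \<beta> then 1 else 0))"

text \<open>
  The strong operator topology on operators into the scalar field, i.e. the topology of pointwise
  convergence, is the weak* topology of the dual.
\<close>

abbreviation weak_star_topology :: "('a::real_normed_vector \<Rightarrow>\<^sub>L real) topology" where
  "weak_star_topology \<equiv> strong_operator_topology"

definition M_basis :: "'i set \<Rightarrow> ('i \<Rightarrow> 'a::banach) \<Rightarrow> ('i \<Rightarrow> 'a \<Rightarrow>\<^sub>L real) \<Rightarrow> bool" where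
  "M_basis \<Gamma> x x' \<longleftrightarrow>
     biorthogonal_system UNIV \<Gamma> x (\<lambda>\<gamma>. blinfun_apply (x' \<gamma>)) \<and>
     closure (span (x ` \<Gamma>)) = UNIV \<and>
     weak_star_topology closure_of span (x' ` \<Gamma>) = UNIV"

text \<open>
  The index set is taken inside the space itself. This is no restriction, as the vectors of a
  biorthogonal system are pairwise distinct (lemma \<open>WLD_I\<close>).
\<close>

definition WLD :: "'a::banach itself \<Rightarrow> bool" where
  "WLD _ \<longleftrightarrow> (\<exists>(\<Gamma> :: 'a set) (x :: 'a \<Rightarrow> 'a) (x' :: 'a \<Rightarrow> 'a \<Rightarrow>\<^sub>L real).
     M_basis \<Gamma> x x' \<and>
     (\<forall>f :: 'a \<Rightarrow>\<^sub>L real. countable {\<gamma>\<in>\<Gamma>. blinfun_apply f (x \<gamma>) \<noteq> 0}))"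

lemma biorthogonal_system_inj_on:
  assumes "biorthogonal_system Z \<Gamma> z z'"
  shows "inj_on z \<Gamma>"
  using assms unfolding biorthogonal_system_def inj_on_def by (metis zero_neq_one)

lemma WLD_I:
  fixes x :: "'i \<Rightarrow> 'a::banach"
  assumes M: "M_basis \<Gamma> x x'"
    and c: "\<And>f :: 'a \<Rightarrow>\<^sub>L real. countable {\<gamma>\<in>\<Gamma>. blinfun_apply f (x \<gamma>) \<noteq> 0}"
  shows "WLD TYPE('a)"
proof -
  let ?g = "inv_into \<Gamma> x"
  have inj: "inj_on x \<Gamma>"
    using M biorthogonal_system_inj_on unfolding M_basis_def by blast
  then have g: "?g (x \<gamma>) = \<gamma>" if "\<gamma> \<in> \<Gamma>" for \<gamma>
    using that by simp
  have "(\<lambda>v. x' (?g v)) ` x ` \<Gamma> = x' ` \<Gamma>"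
    using g by (simp add: image_image)
  moreover have "biorthogonal_system UNIV (x ` \<Gamma>) id (\<lambda>v. blinfun_apply (x' (?g v)))"
    using M inj g unfolding M_basis_def biorthogonal_system_def
    by (auto simp: inj_on_eq_iff)
  ultimately have "M_basis (x ` \<Gamma>) id (\<lambda>v. x' (?g v))"
    using M unfolding M_basis_def by simp
  moreover have "countable {v \<in> x ` \<Gamma>. blinfun_apply f (id v) \<noteq> 0}" for f :: "'a \<Rightarrow>\<^sub>L real"
  proof -
    have "{v \<in> x ` \<Gamma>. blinfun_apply f (id v) \<noteq> 0} = x ` {\<gamma>\<in>\<Gamma>. blinfun_apply f (x \<gamma>) \<noteq> 0}"
      by auto
    then show ?thesis
      using c by simp
  qed
  ultimately show ?thesis
    unfolding WLD_def by blast
qed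

definition dens :: "'a::topological_space itself \<Rightarrow> 'a rel" where
  "dens _ = |SOME D :: 'a set. closure D = UNIV \<and> (\<forall>E :: 'a set. closure E = UNIV \<longrightarrow> |D| \<le>o |E| )|"

lemma dens_least:
  shows "\<exists>D :: 'a::topological_space set. closure D = UNIV \<and> dens TYPE('a) = |D|"
    and "closure (E :: 'a set) = UNIV \<Longrightarrow> dens TYPE('a) \<le>o |E|"
proof -
  let ?P = "\<lambda>D :: 'a set. closure D = UNIV \<and> (\<forall>E :: 'a set. closure E = UNIV \<longrightarrow> |D| \<le>o |E| )"
  have "card_of ` {D :: 'a set. closure D = UNIV} \<noteq> {}"
    using closure_UNIV by blast
  then have "\<exists>r \<in> card_of ` {D :: 'a set. closure D = UNIV}.
      \<forall>s \<in> card_of ` {D :: 'a set. closure D = UNIV}. r \<le>o s"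
    by (intro exists_minim_Card_order) (auto simp: card_of_Card_order)
  then have "\<exists>D. ?P D"
    by auto
  then have "?P (SOME D. ?P D)"
    by (rule someI_ex)
  then show "\<exists>D :: 'a set. closure D = UNIV \<and> dens TYPE('a) = |D|"
    and "closure (E :: 'a set) = UNIV \<Longrightarrow> dens TYPE('a) \<le>o |E|"
    unfolding dens_def by blast+
qed

abbreviation continuum :: "real rel" where
  "continuum \<equiv> |UNIV :: real set|"

end

theory Submission
  imports Defs "HOL-Library.Countable_Set_Type"
begin

text \<open>
  Every vector has countable support with respect to the M-basis. By density pick, for each index
  \<open>\<gamma>\<close>, a vector of \<open>Y\<close> whose support contains \<open>\<gamma>\<close>. A set of indices that is free for the set
  mapping sending \<open>\<gamma>\<close> to this support turns, after normalization, into a biorthogonal system, and a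
  free set of size \<open>\<cc>\<^sup>+\<close> exists because the supports are countable and the index set
  has more than \<open>\<cc> \<ge> \<aleph>\<^sub>1\<close> elements.

  For the latter, suppose that all free sets have size at most \<open>\<cc>\<close>, and choose recursively disjoint
  sets \<open>H\<^sub>u\<close> for \<open>u\<close> in a well-ordered set of size \<open>\<cc>\<close>, each \<open>H\<^sub>u\<close> maximal free outside the previous
  ones. Some index \<open>x\<close> lies neither in their union nor in the support attached to any of its
  elements. By maximality the support attached to \<open>x\<close> meets every \<open>H\<^sub>u\<close>, so it is uncountable.
\<close>

section \<open>Free sets of set mappings with countable values\<close>

text \<open>Pairs with \<open>a = b\<close> are exempt because in the application each index lies in
  its own support \<open>F a\<close>.\<close>

definition free_set :: "('i \<Rightarrow> 'i set) \<Rightarrow> 'i set \<Rightarrow> bool" where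
  "free_set F H \<longleftrightarrow> (\<forall>a\<in>H. \<forall>b\<in>H. a \<noteq> b \<longrightarrow> b \<notin> F a)"

text \<open>Zorn's lemma applies because freeness is a condition on pairs, and any two elements of
  the union of a chain lie in one member of the chain.\<close>

lemma maximal_free_set_exists:
  "\<exists>H\<subseteq>A. free_set F H \<and> (\<forall>z\<in>A - H. \<not> free_set F (insert z H))"
proof -
  let ?S = "{H. H \<subseteq> A \<and> free_set F H}"
  have "\<Union>C \<in> ?S" if "C \<in> chains ?S" for C
  proof -
    have C: "C \<subseteq> ?S" and lin: "\<And>P Q. P \<in> C \<Longrightarrow> Q \<in> C \<Longrightarrow> P \<subseteq> Q \<or> Q \<subseteq> P"
      using that by (auto simp: chains_def chain_subset_def)
    have "b \<notin> F a" if ab: "a \<in> P" "P \<in> C" "b \<in> Q" "Q \<in> C" "a \<noteq> b" for a b P Q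
      using lin[OF ab(2,4)] C ab unfolding free_set_def by blast
    then show ?thesis
      using C unfolding free_set_def by blast
  qed
  then have "\<exists>M\<in>?S. \<forall>H\<in>?S. M \<subseteq> H \<longrightarrow> H = M"
    by (intro Zorn_Lemma ballI)
  then obtain M where M: "M \<in> ?S" and max: "\<forall>H\<in>?S. M \<subseteq> H \<longrightarrow> H = M"
    by (rule bexE)
  have "\<not> free_set F (insert z M)" if "z \<in> A - M" for z
  proof
    assume "free_set F (insert z M)"
    then have "insert z M \<in> ?S"
      using M that by auto
    then have "insert z M = M"
      using max by blast
    then show False
      using that by blast
  qed
  then show ?thesis
    using M by blast
qed

lemma large_free_set_exists:
  fixes U :: "'u set" and \<Gamma> :: "'i set"
  assumes countable_F: "\<And>\<gamma>. \<gamma> \<in> \<Gamma> \<Longrightarrow> countable (F \<gamma>)"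
    and uncountable_U: "uncountable U"
    and U_less: "|U| <o |\<Gamma>|"
  shows "\<exists>H\<subseteq>\<Gamma>. free_set F H \<and> |U| <o |H|"
proof (rule ccontr)
  assume "\<not> ?thesis"
  then have small: "|H| \<le>o |U|" if "H \<subseteq> \<Gamma>" "free_set F H" for H
    using that by (auto simp: not_ordLess_iff_ordLeq card_of_Well_order)
  have inf: "infinite U"
    using uncountable_U countable_finite by blast
  \<comment> \<open>The cardinal \<open>|U|\<close> is itself a well-order of \<open>U\<close>; its
    strict part drives the recursion.\<close>
  define R where "R = |U| - Id"
  \<comment> \<open>A relation rather than a function, since maximal free sets are not unique: one
    is chosen at each stage.\<close>
  define P where "P H u M \<longleftrightarrow> M \<subseteq> \<Gamma> - (\<Union>v\<in>{v. (v, u) \<in> R}. H v) \<and> free_set F M \<and>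
      (\<forall>z \<in> \<Gamma> - (\<Union>v\<in>{v. (v, u) \<in> R}. H v) - M. \<not> free_set F (insert z M))"
    for H :: "'u \<Rightarrow> 'i set" and u M
  have "wf R"
    unfolding R_def using card_of_Well_order[of U] by (simp add: well_order_on_def)
  \<comment> \<open>Stage \<open>u\<close> depends only on the sets chosen before it, as the
    recursion principle requires.\<close>
  moreover have "P f u M = P g u M" if "\<And>v. (v, u) \<in> R \<Longrightarrow> f v = g v" for f g u M
  proof -
    have "(\<Union>v\<in>{v. (v, u) \<in> R}. f v) = (\<Union>v\<in>{v. (v, u) \<in> R}. g v)"
      using that by auto
    then show ?thesis
      by (simp add: P_def)
  qed
  moreover have "\<exists>M. P f u M" for f u
    using maximal_free_set_exists[of "\<Gamma> - (\<Union>v\<in>{v. (v, u) \<in> R}. f v)" F]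
    unfolding P_def by blast
  ultimately obtain H where H: "\<And>u. P H u (H u)"
    using dependent_wf_choice[of R P] by metis
  have H_sub: "H u \<subseteq> \<Gamma>" and H_free: "free_set F (H u)" for u
    using H[of u] unfolding P_def by auto
  have R_field: "v \<in> U" if "(v, u) \<in> R" for u v
    using that FieldI1[of v u "|U|"] by (simp add: R_def Field_card_of)
  \<comment> \<open>A point outside all the sets was still available at stage \<open>u\<close>, so
    maximality applies to it.\<close>
  have H_max: "\<not> free_set F (insert z (H u))" if "z \<in> \<Gamma>" "\<And>v. v \<in> U \<Longrightarrow> z \<notin> H v" "u \<in> U" for z u
    using H[of u] that R_field unfolding P_def by blast
  have disj: "H u \<inter> H v = {}" if "u \<in> U" "v \<in> U" "u \<noteq> v" for u v
  proof -
    have "(u, v) \<in> R \<or> (v, u) \<in> R"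
      using that card_of_Well_order[of U] unfolding R_def well_order_on_def linear_order_on_def total_on_def
      by (auto simp: Field_card_of)
    then show ?thesis
      using H[of u] H[of v] unfolding P_def by blast
  qed
  define B where "B = (\<Union>u\<in>U. H u)"
  have B: "|B| \<le>o |U|"
    unfolding B_def using small[OF H_sub H_free] inf
    by (intro card_of_UNION_ordLeq_infinite) (auto simp: ordLeq_refl card_of_Card_order)
  have "|F b| \<le>o |U|" if "b \<in> B" for b
  proof -
    have "countable (F b)"
      using that H_sub countable_F unfolding B_def by blast
    then show ?thesis
      using inf by (meson countable_card_of_nat infinite_iff_card_of_nat[THEN iffD1] ordLeq_transitive)
  qed
  then have "|\<Union>b\<in>B. F b| \<le>o |U|"
    using B inf by (intro card_of_UNION_ordLeq_infinite) auto
  then have "|B \<union> (\<Union>b\<in>B. F b)| \<le>o |U|"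
    using B inf
    by (intro card_of_Un_ordLeq_infinite_Field card_of_Card_order) (auto simp: Field_card_of)
  then have "\<not> \<Gamma> \<subseteq> B \<union> (\<Union>b\<in>B. F b)"
    using not_ordLess_ordLeq[OF U_less] ordLeq_transitive[OF card_of_mono1] by blast
  then obtain x where x: "x \<in> \<Gamma>" "x \<notin> B" "\<And>b. b \<in> B \<Longrightarrow> x \<notin> F b"
    by blast
  \<comment> \<open>The pair that destroys freeness must involve \<open>x\<close>. Since
    \<open>x\<close> avoids \<open>F b\<close> for every \<open>b\<close> in \<open>H u\<close>, it
    is some element of \<open>H u\<close> that lies in \<open>F x\<close>.\<close>
  have "\<exists>h. h \<in> F x \<inter> H u" if "u \<in> U" for u
  proof -
    have "\<not> free_set F (insert x (H u))"
      using H_max x that unfolding B_def by blast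
    then show ?thesis
      using H_free[of u] x that unfolding free_set_def B_def by blast
  qed
  then obtain h where h: "\<And>u. u \<in> U \<Longrightarrow> h u \<in> F x \<inter> H u"
    by metis
  have "inj_on h U"
  proof (rule inj_onI, rule ccontr)
    fix u v assume uv: "u \<in> U" "v \<in> U" "h u = h v" "u \<noteq> v"
    then have "h u \<in> H u \<inter> H v"
      using h[of u] h[of v] by auto
    then show False
      using disj[of u v] uv by auto
  qed
  moreover have "countable (h ` U)"
    using h by (intro countable_subset[OF _ countable_F[OF x(1)]]) auto
  ultimately show False
    using uncountable_U countable_image_inj_on by blast
qed

section \<open>Size of an M-basis and countability of supports\<close>

text \<open>The span is covered by the countably many sets \<open>T n\<close> of sums of
  \<open>n\<close> scalar multiples of elements of \<open>S\<close>, each of size at most that of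
  the continuum.\<close>

lemma card_of_span_le:
  fixes S :: "'a::real_vector set"
  assumes "|S| \<le>o continuum"
  shows "|span S| \<le>o continuum"
proof -
  define T where
    "T = rec_nat {0} (\<lambda>_ A. (\<lambda>((c :: real, s), y :: 'a). c *\<^sub>R s + y) ` ((UNIV \<times> S) \<times> A))"
  have T_0: "T 0 = {0}"
    and T_Suc: "T (Suc n) = (\<lambda>((c, s), y). c *\<^sub>R s + y) ` ((UNIV \<times> S) \<times> T n)" for n
    by (simp_all add: T_def)
  have inf: "infinite (UNIV :: real set)"
    by (rule infinite_UNIV_char_0)
  have "\<exists>n. y \<in> T n" if "y \<in> span S" for y
    using that
  proof (induction rule: span_induct_alt)
    case base
    show ?case
      using T_0 by blast
  next
    case (step c s y)
    then obtain n where "y \<in> T n"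
      by blast
    with step have "c *\<^sub>R s + y \<in> T (Suc n)"
      unfolding T_Suc by force
    then show ?case ..
  qed
  then have "span S \<subseteq> (\<Union>n. T n)"
    by blast
  then have "|span S| \<le>o |\<Union>n. T n|"
    by (rule card_of_mono1)
  moreover have "|T n| \<le>o continuum" for n
  proof (induction n)
    case 0
    show ?case
      using inf by (simp add: T_0 card_of_singl_ordLeq)
  next
    case (Suc n)
    then have "|((UNIV :: real set) \<times> S) \<times> T n| \<le>o continuum"
      using assms inf
      by (intro card_of_Sigma_ordLeq_infinite ballI) (auto simp: ordLeq_refl card_of_Card_order)
    then show ?case
      unfolding T_Suc using card_of_image ordLeq_transitive by blast
  qed
  then have "|\<Union>n. T n| \<le>o continuum"
    using inf infinite_iff_card_of_nat by (intro card_of_UNION_ordLeq_infinite) auto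
  ultimately show ?thesis
    by (rule ordLeq_transitive)
qed

text \<open>Write \<open>y\<close> as the limit of a sequence in the span. By continuity, a
  coordinate vanishing along the whole sequence vanishes at \<open>y\<close>, so the support of
  \<open>y\<close> lies in a countable union of countable supports.\<close>

lemma countable_support:
  fixes x :: "'i \<Rightarrow> 'a::banach"
  assumes "M_basis \<Gamma> x x'"
  shows "countable {\<gamma>\<in>\<Gamma>. blinfun_apply (x' \<gamma>) y \<noteq> 0}"
proof -
  let ?supp = "\<lambda>y. {\<gamma>\<in>\<Gamma>. blinfun_apply (x' \<gamma>) y \<noteq> 0}"
  have bi: "blinfun_apply (x' \<alpha>) (x \<beta>) = (if \<alpha> = \<beta> then 1 else 0)"
    if "\<alpha> \<in> \<Gamma>" "\<beta> \<in> \<Gamma>" for \<alpha> \<beta>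
    using assms that unfolding M_basis_def biorthogonal_system_def by blast
  have span: "countable (?supp s)" if "s \<in> span (x ` \<Gamma>)" for s
    using that
  proof (induction rule: span_induct_alt)
    case base
    show ?case by simp
  next
    case (step c v s)
    then obtain \<beta> where \<beta>: "\<beta> \<in> \<Gamma>" "v = x \<beta>"
      by blast
    have "?supp (c *\<^sub>R v + s) \<subseteq> insert \<beta> (?supp s)"
      using \<beta> by (auto simp: blinfun.add_right blinfun.scaleR_right bi split: if_splits)
    then show ?case
      using step by (meson countable_insert countable_subset)
  qed
  have "y \<in> closure (span (x ` \<Gamma>))"
    using assms unfolding M_basis_def by simp
  then obtain s where s: "\<And>n. s n \<in> span (x ` \<Gamma>)" "s \<longlonglongrightarrow> y"
    unfolding closure_sequential by blast
  have "?supp y \<subseteq> (\<Union>n. ?supp (s n))"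
  proof (rule ccontr)
    assume "\<not> ?thesis"
    then obtain \<gamma> where "blinfun_apply (x' \<gamma>) y \<noteq> 0" and "\<And>n. blinfun_apply (x' \<gamma>) (s n) = 0"
      by blast
    moreover have "(\<lambda>n. blinfun_apply (x' \<gamma>) (s n)) \<longlonglongrightarrow> blinfun_apply (x' \<gamma>) y"
      by (intro tendsto_intros s)
    ultimately show False
      using LIMSEQ_unique[OF _ tendsto_const] by fastforce
  qed
  moreover have "countable (\<Union>n. ?supp (s n))"
    using span s by (intro countable_UN) auto
  ultimately show ?thesis
    by (rule countable_subset)
qed

text \<open>Otherwise the span of the basis vectors would be a dense set of size at most that of the
  continuum.\<close>

lemma card_of_M_basis_ge_dens:
  fixes x :: "'i \<Rightarrow> 'a::banach"
  assumes "M_basis \<Gamma> x x'" and "dens TYPE('a) =o cardSuc continuum"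
  shows "continuum <o |\<Gamma>|"
proof (rule ccontr)
  assume "\<not> ?thesis"
  then have "|\<Gamma>| \<le>o continuum"
    by (simp add: not_ordLess_iff_ordLeq card_of_Well_order)
  then have "|x ` \<Gamma>| \<le>o continuum"
    using card_of_image ordLeq_transitive by blast
  then have "|span (x ` \<Gamma>)| \<le>o continuum"
    by (rule card_of_span_le)
  moreover have "dens TYPE('a) \<le>o |span (x ` \<Gamma>)|"
    using assms unfolding M_basis_def by (intro dens_least) blast
  ultimately have "cardSuc continuum \<le>o continuum"
    using assms(2) by (meson ordIso_ordLeq_trans ordIso_symmetric ordLeq_transitive)
  then show False
    using cardSuc_greater[OF card_of_Card_order] not_ordLess_ordLeq by blast
qed

text \<open>The kernel of \<open>f\<close> is closed, so if it contained a dense set it would be the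
  whole space.\<close>

lemma dense_not_in_kernel:
  assumes "closure Y = UNIV" and "blinfun_apply f x \<noteq> (0::real)"
  obtains y where "y \<in> Y" "blinfun_apply f y \<noteq> 0"
proof -
  have "closed {y. blinfun_apply f y = 0}"
    by (intro closed_Collect_eq continuous_intros)
  then have "\<not> Y \<subseteq> {y. blinfun_apply f y = 0}"
    using assms closure_minimal by blast
  then show ?thesis
    using that by blast
qed

lemma exists_subset_card_of_ordIso:
  fixes r :: "'b rel" and A :: "'a set"
  assumes "Card_order r" and "r \<le>o |A|"
  shows "\<exists>B\<subseteq>A. |B| =o r"
proof -
  have "|Field r| \<le>o |A|"
    using assms card_of_Field_ordIso ordIso_ordLeq_trans by blast
  then obtain f where f: "inj_on f (Field r)" "f ` Field r \<subseteq> A"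
    by (auto simp flip: card_of_ordLeq)
  then have "|Field r| =o |f ` Field r|"
    by (meson card_of_ordIso inj_on_imp_bij_betw)
  then show ?thesis
    using f assms(1) by (meson card_of_Field_ordIso ordIso_symmetric ordIso_transitive)
qed

section \<open>From a free set to a biorthogonal system\<close>

theorem theoremC:
  fixes Y :: "'a::banach set"
  assumes "WLD TYPE('a)"
    and "dens TYPE('a) =o cardSuc continuum"
    and "subspace Y"
    and "closure Y = UNIV"
  shows "\<exists>(\<Gamma> :: 'a set) (y :: 'a \<Rightarrow> 'a) (y' :: 'a \<Rightarrow> 'a \<Rightarrow> real).
    biorthogonal_system Y \<Gamma> y y' \<and> |\<Gamma>| =o cardSuc continuum"
proof -
  obtain \<Gamma> :: "'a set" and x and x' :: "'a \<Rightarrow> 'a \<Rightarrow>\<^sub>L real" where M: "M_basis \<Gamma> x x'"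
    using assms(1) unfolding WLD_def by blast
  have "\<exists>y\<in>Y. blinfun_apply (x' \<gamma>) y \<noteq> 0" if "\<gamma> \<in> \<Gamma>" for \<gamma>
  proof -
    have "blinfun_apply (x' \<gamma>) (x \<gamma>) \<noteq> 0"
      using M that unfolding M_basis_def biorthogonal_system_def by auto
    then show ?thesis
      using dense_not_in_kernel[OF assms(4)] by metis
  qed
  then obtain z where z: "\<And>\<gamma>. \<gamma> \<in> \<Gamma> \<Longrightarrow> z \<gamma> \<in> Y" "\<And>\<gamma>. \<gamma> \<in> \<Gamma> \<Longrightarrow> blinfun_apply (x' \<gamma>) (z \<gamma>) \<noteq> 0"
    by metis
  define F where "F \<gamma> = {\<alpha>\<in>\<Gamma>. blinfun_apply (x' \<alpha>) (z \<gamma>) \<noteq> 0}" for \<gamma>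
  \<comment> \<open>The real line serves here only as an uncountable index set of size
    continuum.\<close>
  have "\<exists>H\<subseteq>\<Gamma>. free_set F H \<and> continuum <o |H|"
    using countable_support[OF M] card_of_M_basis_ge_dens[OF M assms(2)] uncountable_UNIV_real
    by (intro large_free_set_exists) (simp_all add: F_def)
  then obtain H where H: "H \<subseteq> \<Gamma>" "free_set F H" "continuum <o |H|"
    by blast
  have "cardSuc continuum \<le>o |H|"
    using H(3) by (intro cardSuc_least card_of_Card_order)
  \<comment> \<open>The free set may be too large; subsets of free sets are free, so it can be cut
    down to the exact cardinality.\<close>
  then obtain G where G: "G \<subseteq> H" "|G| =o cardSuc continuum"
    using exists_subset_card_of_ordIso cardSuc_Card_order[OF card_of_Card_order] by blast
  let ?y = "\<lambda>\<gamma>. z \<gamma> /\<^sub>R blinfun_apply (x' \<gamma>) (z \<gamma>)"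
  have "?y \<gamma> \<in> Y" if "\<gamma> \<in> G" for \<gamma>
    using that z G H assms(3) by (blast intro: subspace_scale)
  moreover have "blinfun_apply (x' \<gamma>) \<in> dual_on Y" for \<gamma>
    using dual_on_UNIV[of "blinfun_apply (x' \<gamma>)"] blinfun.bounded_linear_right
    unfolding dual_on_def by blast
  moreover have "blinfun_apply (x' \<alpha>) (?y \<beta>) = (if \<alpha> = \<beta> then 1 else 0)"
    if "\<alpha> \<in> G" "\<beta> \<in> G" for \<alpha> \<beta>
  proof (cases "\<alpha> = \<beta>")
    case True
    then show ?thesis
      using that z G H by (auto simp: blinfun.scaleR_right)
  next
    case False
    moreover have in_H: "\<alpha> \<in> H" "\<beta> \<in> H"
      using that G(1) by auto
    \<comment> \<open>Freeness gives the off-diagonal zeros: the support of \<open>z \<beta>\<close>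
      misses every other index of \<open>H\<close>.\<close>
    ultimately have "\<alpha> \<notin> F \<beta>"
      using H(2) unfolding free_set_def by metis
    then have "blinfun_apply (x' \<alpha>) (z \<beta>) = 0"
      using in_H(1) H(1) unfolding F_def by auto
    then show ?thesis
      using False by (simp add: blinfun.scaleR_right)
  qed
  ultimately have "biorthogonal_system Y G ?y (\<lambda>\<gamma>. blinfun_apply (x' \<gamma>))"
    unfolding biorthogonal_system_def by blast
  then show ?thesis
    using G(2) by blast
qed

end
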